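(* Let $b$ be an integer with $2\le b\le 10$. All solutions of $$P_n=b^{d}P_m+Q_k$$ in integers $n,k\ge 0$ and $m\ge 1$, where $d$ is the number of digits of $Q_k$ in base $b$, are given by the following representations (in particular $P_n\in\{5,12,70\}$): $$5=P_3=3^1P_1+Q_0=3^1P_1+Q_1,$$ $$12=P_4=5^1P_2+Q_0=5^1P_2+Q_1,$$ $$12=P_4=10^1P_1+Q_0=10^1P_1+Q_1,$$ $$70=P_6=6^2P_1+Q_4.$$
   Context: $(P_n)_{n\ge0}$ is the Pell sequence: $P_0=0$, $P_1=1$, $P_n=2P_{n-1}+P_{n-2}$ for $n\ge2$. $(Q_n)_{n\ge0}$ is the Pell–Lucas sequence: $Q_0=2$, $Q_1=2$, $Q_n=2Q_{n-1}+Q_{n-2}$ for $n\ge2$. For a positive integer $N$, the number of digits of $N$ in base $b$ is $\lfloor \log_b N\rfloor+1$. (For $m=0$ the equation reduces to $P_n=Q_k$, whose only solutions are $P_2=Q_0=Q_1$; these are excluded by the hypothesis $m\ge1$.) *)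

theory Defs
  imports Complex_Main
begin

fun pell :: "nat \<Rightarrow> nat" where
  "pell 0 = 0"
| "pell (Suc 0) = 1"
| "pell (Suc (Suc n)) = 2 * pell (Suc n) + pell n"

fun pell_lucas :: "nat \<Rightarrow> nat" where
  "pell_lucas 0 = 2"
| "pell_lucas (Suc 0) = 2"
| "pell_lucas (Suc (Suc n)) = 2 * pell_lucas (Suc n) + pell_lucas n"

definition num_digits :: "nat \<Rightarrow> nat \<Rightarrow> nat" where
  "num_digits b N = nat (\<lfloor>log (real b) (real N)\<rfloor> + 1)"

end

theory Submission
  imports Defs
begin

text \<open>
  The number \<open>b\<^sup>d\<close> lies between \<open>Q\<^sub>k\<close> and \<open>b Q\<^sub>k\<close>, so comparing sizes forces \<open>n = m + k + j\<close> with
  \<open>j \<in> {1, 2}\<close> (or \<open>k = 0\<close> and \<open>j = 3\<close>). Next, \<open>P\<^sub>m\<close> divides \<open>P\<^bsub>m+k+j\<^esub> - Q\<^sub>k\<close>. Modulo \<open>P\<^sub>m\<close>, shifting an index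
  by \<open>m\<close> multiplies Pell and Pell-Lucas numbers by the unit \<open>P\<^bsub>m+1\<^esub>\<close>, so \<open>k\<close> may be replaced by its
  residue \<open>s < m\<close>; by the reflection \<open>P\<^bsub>m+x\<^esub> \<equiv> \<plusminus>P\<^bsub>m-x\<^esub>\<close>, the number \<open>P\<^sub>m\<close> then divides \<open>Q\<^sub>s \<plusminus> P\<^bsub>m-s-j\<^esub>\<close>,
  which is too small unless \<open>m \<le> 5\<close>. This replaces the linear forms in logarithms that one would
  expect here. For each of the finitely many triples \<open>(b, m, j)\<close> that remain, the equation
  \<open>b\<^sup>d P\<^sub>m = P\<^bsub>m+k+j\<^esub> - Q\<^sub>k\<close> in \<open>k\<close> and \<open>d\<close> has no solution modulo a suitable integer once \<open>d\<close> is not tiny.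
\<close>

section \<open>Growth and identities of the Pell and Pell-Lucas numbers\<close>

lemma pell_mono: "i \<le> j \<Longrightarrow> pell i \<le> pell j"
proof (induction rule: dec_induct)
  case (step n)
  have "pell n \<le> pell (Suc n)" by (cases n) auto
  with step show ?case by simp
qed simp

lemma pell_pos: "0 < n \<Longrightarrow> 0 < pell n"
  using pell_mono[of 1 n] by simp

lemma pell_strict_mono_Suc: "0 < j \<Longrightarrow> pell (Suc j) > pell j"
  using pell_pos[of j] by (cases j) auto

lemma pell_less: "i < j \<Longrightarrow> 2 \<le> j \<Longrightarrow> pell i < pell j"
  using pell_mono[of i "j - 1"] pell_strict_mono_Suc[of "j - 1"]
  by (cases j) (auto intro: le_less_trans)

lemma pell_lucas_mono: "i \<le> j \<Longrightarrow> pell_lucas i \<le> pell_lucas j"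
proof (induction rule: dec_induct)
  case (step n)
  have "pell_lucas n \<le> pell_lucas (Suc n)" by (cases n) auto
  with step show ?case by simp
qed simp

lemma pell_lucas_ge: "2 \<le> pell_lucas n"
  using pell_lucas_mono[of 0 n] by simp

lemma pell_lucas_Suc: "pell_lucas (Suc n) = pell (Suc (Suc n)) + pell n"
  by (induction n rule: pell.induct) auto

lemma int_pell_lucas: "int (pell_lucas n) = 2 * int (pell (Suc n)) - 2 * int (pell n)"
  by (induction n rule: pell.induct) auto

lemma pell_less_pell_lucas: "pell n < pell_lucas n"
  by (induction n rule: pell.induct) auto

lemma pell_add: "pell (Suc (m + n)) = pell (Suc m) * pell (Suc n) + pell m * pell n"
proof (induction m arbitrary: n)
  case (Suc m)
  show ?case using Suc.IH[of "Suc n"] by (simp add: algebra_simps)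
qed simp

text \<open>The last factor is P_(n-1), written so that \<open>n = 0\<close> fits without a negative
  index.\<close>

lemma int_pell_add:
  "int (pell (m + n)) =
     int (pell (Suc m)) * int (pell n) + int (pell m) * (int (pell (Suc n)) - 2 * int (pell n))"
proof (cases n)
  case (Suc l)
  then show ?thesis using pell_add[of m l] by (simp add: algebra_simps)
qed simp

lemma pell_cassini:
  "int (pell (Suc n)) ^ 2 - 2 * int (pell n) * int (pell (Suc n)) - int (pell n) ^ 2 = (-1) ^ n"
proof (induction n)
  case (Suc n)
  then show ?case by (simp add: algebra_simps power2_eq_square)
qed simp

lemma coprime_pell_Suc: "coprime (pell n) (pell (Suc n))"
proof (induction n)
  case (Suc n)
  then show ?case
    by (metis coprime_commute coprime_iff_gcd_eq_1 gcd.commute gcd_add_mult mult.commute pell.simps(3) add.commute)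
qed simp

text \<open>The addition formula expands every shifted term and Cassini's identity turns (-1)^x into
  a quadratic form, leaving a polynomial identity. Modulo P_(y+x) it says that P_(y+2x) is P_y up to
  sign.\<close>

lemma pell_reflection:
  "int (pell (y + 2 * x)) = int (pell_lucas x) * int (pell (y + x)) - (-1) ^ x * int (pell y)"
proof -
  define A B C D where "A = int (pell x)" "B = int (pell (Suc x))"
    "C = int (pell y)" "D = int (pell (Suc y))"
  note defs = A_B_C_D_def
  have 1: "int (pell (x + y)) = B * C + A * (D - 2 * C)"
    using int_pell_add[of x y] by (simp add: defs)
  have 2: "int (pell (x + x)) = B * A + A * (B - 2 * A)"
    using int_pell_add[of x x] by (simp add: defs)
  have 3: "int (pell (Suc (x + x))) = B * B + A * A"
    using pell_add[of x x] by (simp add: defs)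
  have 4: "int (pell (x + x + y)) = int (pell (Suc (x + x))) * C + int (pell (x + x)) * (D - 2 * C)"
    using int_pell_add[of "x + x" y] by (simp add: defs)
  have 5: "int (pell_lucas x) = 2 * B - 2 * A" by (simp add: int_pell_lucas defs)
  have 6: "(-1) ^ x = B ^ 2 - 2 * A * B - A ^ 2"
    using pell_cassini[of x] by (simp add: defs)
  have "int (pell (x + x + y)) = int (pell_lucas x) * int (pell (x + y)) - (-1) ^ x * C"
    unfolding 4 3 2 5 1 6 by (simp add: algebra_simps power2_eq_square)
  moreover have "x + x + y = y + 2 * x" "x + y = y + x" by auto
  ultimately show ?thesis by (simp add: defs)
qed

section \<open>Digit counts\<close>

lemma num_digits_eqI:
  assumes "2 \<le> b" "b ^ e \<le> N" "N < b ^ Suc e"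
  shows "num_digits b N = Suc e"
proof -
  have "0 < b ^ e" using assms by simp
  hence "0 < N" using assms(2) by linarith
  have "\<lfloor>log (real b) (real N)\<rfloor> = int e"
    using floor_log_nat_eq_if[OF assms(2), of ] assms by simp
  thus ?thesis by (simp add: num_digits_def)
qed

text \<open>The search for solutions uses the digit count only through these two inequalities, so no
  logarithm is met again there.\<close>

lemma num_digits_bounds:
  assumes "2 \<le> b" "0 < N"
  shows "N < b ^ num_digits b N" "b ^ num_digits b N \<le> b * N"
proof -
  obtain e where e: "b ^ e \<le> N" "N < b ^ Suc e"
    using ex_power_ivl1[of b N] assms by auto
  have "num_digits b N = Suc e" by (rule num_digits_eqI) (use assms e in auto)
  with e show "N < b ^ num_digits b N" "b ^ num_digits b N \<le> b * N" by auto
qed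

section \<open>Size comparison of n with m + k\<close>

text \<open>Lowering both indices by one only flips the sign of the difference; once an index is 0,
  it is twice a Pell number up to sign.\<close>

lemma pell_cross_bound:
  "\<bar>int (pell_lucas m) * int (pell k) - int (pell m) * int (pell_lucas k)\<bar>
     \<le> 2 * (int (pell m) + int (pell k))"
proof (induction m arbitrary: k)
  case (Suc m)
  show ?case
  proof (cases k)
    case (Suc l)
    have "int (pell_lucas (Suc m)) * int (pell k) - int (pell (Suc m)) * int (pell_lucas k)
        = - (int (pell_lucas m) * int (pell l) - int (pell m) * int (pell_lucas l))"
      unfolding Suc int_pell_lucas by (simp add: algebra_simps)
    moreover have "pell m \<le> pell (Suc m)" "pell l \<le> pell k" by (auto intro: pell_mono simp: Suc)
    ultimately show ?thesis using Suc.IH[of l] by (smt (verit) of_nat_mono)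
  qed simp
qed simp

text \<open>Since 2 P_(m+k) = P_m Q_k + Q_m P_k, the cross bound lets P_m Q_k replace the second
  product. The right side is at most B P_m + Q_k for every B > Q_k, which yields P_(m+k) <
  P_n.\<close>

lemma pell_add_upper:
  "pell (m + k) < pell_lucas k * pell m + pell m + pell_lucas k"
proof -
  have "2 * int (pell (m + k)) = int (pell m) * int (pell_lucas k) + int (pell_lucas m) * int (pell k)"
    unfolding int_pell_add int_pell_lucas by (simp add: algebra_simps)
  hence "int (pell (m + k)) \<le> int (pell m) * int (pell_lucas k) + int (pell m) + int (pell k)"
    using pell_cross_bound[of m k] by (smt (verit))
  hence "pell (m + k) \<le> pell m * pell_lucas k + pell m + pell k"
    by (metis of_nat_add of_nat_le_iff of_nat_mult)
  thus ?thesis using pell_less_pell_lucas[of k] by (simp add: mult.commute)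
qed

lemma pell_add_lower: "pell m * pell (Suc r) \<le> pell (m + r)"
  using pell_add[of "m - 1" r] by (cases m) auto

text \<open>Both sides obey the Pell recurrence, starting from 22 < 29 and 66 < 70. One index lower
  the bound fails (22 against P_4 = 12), which is why the offset 3 survives for k = 0.\<close>

lemma pell_lucas_upper: "11 * pell_lucas (Suc k) < pell (k + 5)"
  by (induction k rule: pell.induct) (auto simp: numeral_eq_Suc)

lemma index_range:
  assumes eq: "pell n = B * pell m + pell_lucas k" and "1 \<le> m"
    and B: "pell_lucas k < B" "B \<le> 10 * pell_lucas k"
  shows "\<exists>j. n = m + k + j \<and> (j = 1 \<or> j = 2 \<or> j = 3 \<and> k = 0)"
proof -
  have "pell_lucas k * pell m + pell m \<le> B * pell m"
    using B(1) by (metis Suc_leI add.commute mult_Suc mult_le_mono1)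
  hence "pell (m + k) < pell n" using pell_add_upper[of m k] eq by linarith
  hence low: "m + k < n" using pell_mono[of n "m + k"] by linarith
  have "1 \<le> pell m" using pell_pos[of m] assms by simp
  \<comment> \<open>Here 11 = 10 + 1: \<open>B\<close> accounts for 10, and the summand Q_k is at
    most Q_k P_m.\<close>
  have up: "pell n \<le> 11 * pell_lucas k * pell m"
  proof -
    have "B * pell m \<le> 10 * pell_lucas k * pell m" using B(2) by simp
    moreover have "pell_lucas k \<le> pell_lucas k * pell m" using \<open>1 \<le> pell m\<close> by simp
    ultimately show ?thesis using eq by linarith
  qed
  have *: "n < m + r" if "11 * pell_lucas k < pell (Suc r)" for r
  proof (rule ccontr)
    assume "\<not> n < m + r"
    hence "pell (m + r) \<le> pell n" by (intro pell_mono) simp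
    hence "pell m * pell (Suc r) \<le> 11 * pell_lucas k * pell m"
      using pell_add_lower[of m r] up by linarith
    thus False using that \<open>1 \<le> pell m\<close> by (simp add: mult.commute)
  qed
  show ?thesis
  proof (cases k)
    case 0
    have "n < m + 4" by (rule *) (simp add: 0 numeral_eq_Suc)
    with low 0 show ?thesis by (intro exI[of _ "n - m - k"]) auto
  next
    case (Suc l)
    have "n < m + (k + 3)"
      by (rule *) (use pell_lucas_upper[of l] in \<open>simp add: Suc numeral_eq_Suc\<close>)
    with low show ?thesis by (intro exI[of _ "n - m - k"]) auto
  qed
qed

section \<open>Bounding m through divisibility by P_m\<close>

lemma pell_dvd_reduce:
  assumes "int (pell m) dvd int (pell (m + k + j)) - int (pell_lucas k)"
  shows "int (pell m) dvd int (pell (m + k mod m + j)) - int (pell_lucas (k mod m))"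
  using assms
proof (induction k rule: less_induct)
  case (less k)
  show ?case
  proof (cases "m = 0 \<or> k < m")
    case True
    then show ?thesis using less.prems by auto
  next
    case False
    define l where "l = k - m"
    have k: "k = m + l" using False by (simp add: l_def)
    define p q where "p = int (pell m)" and "q = int (pell (Suc m))"
    have shift: "int (pell (m + i)) = q * int (pell i) + p * (int (pell (Suc i)) - 2 * int (pell i))" for i
      by (simp add: p_def q_def int_pell_add)
    \<comment> \<open>Writing Q_k as 2 P_(k+1) - 2 P_k leaves only Pell numbers, each shifted by m;
      the second bracket collects the multiples of P_m. The factor \<open>q\<close> is then
      cancelled by coprimality.\<close>
    have "int (pell (m + k + j)) - int (pell_lucas k)
        = q * (int (pell (m + l + j)) - int (pell_lucas l)) +
          p * (int (pell (Suc (m + l + j))) - 2 * int (pell (m + l + j)) -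
            2 * (int (pell (Suc (Suc l))) - 2 * int (pell (Suc l))) +
            2 * (int (pell (Suc l)) - 2 * int (pell l)))"
      using shift[of "m + l + j"] shift[of l] shift[of "Suc l"]
      unfolding int_pell_lucas k by (simp add: algebra_simps)
    hence "p dvd q * (int (pell (m + l + j)) - int (pell_lucas l))"
      using less.prems by (metis p_def dvd_add_left_iff dvd_triv_left)
    moreover have "coprime p q"
      using coprime_pell_Suc[of m] by (simp add: p_def q_def)
    ultimately have "p dvd int (pell (m + l + j)) - int (pell_lucas l)"
      by (simp add: coprime_dvd_mult_right_iff)
    hence "int (pell m) dvd int (pell (m + l mod m + j)) - int (pell_lucas (l mod m))"
      using less.IH[of l] False by (simp add: p_def k)
    thus ?thesis by (simp add: k)
  qed
qed

text \<open>The right side obeys the Pell recurrence in s, and the left side, with its fixed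
  summand, grows no faster. This keeps Q_s + P_y below P_m in
  \<open>multiplier_bound\<close>.\<close>

lemma pell_lucas_add_pell_le:
  assumes "2 \<le> u"
  shows "pell_lucas (Suc s) + pell u \<le> pell (Suc s + u)"
proof (induction s rule: pell.induct)
  case 1
  have "2 \<le> pell u" using assms pell_mono[of 2 u] by (simp add: numeral_eq_Suc)
  moreover have "2 * pell u \<le> pell (Suc u)" using assms by (cases u) auto
  ultimately show ?case by simp
next
  case 2
  have "5 \<le> pell (Suc u)" using assms pell_mono[of 3 "Suc u"] by (simp add: numeral_eq_Suc)
  then show ?case by simp
next
  case (3 n)
  then show ?case by simp
qed

text \<open>For s \<ge> 2, Q_s = P_(s+1) + P_(s-1) lies strictly between P_(s+1) and
  P_(s+2).\<close>

lemma pell_eq_pell_lucas: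
  assumes "pell y = pell_lucas s"
  shows "y = 2 \<and> s \<le> 1"
proof (cases "s \<le> 1")
  case True
  hence y: "pell y = 2" using assms by (cases s) auto
  have "y < 3" using pell_mono[of 3 y] y by (cases "y < 3") (auto simp: numeral_eq_Suc)
  moreover have "1 < y" using pell_mono[of y 1] y by (cases "1 < y") auto
  ultimately show ?thesis using True by simp
next
  case False
  then obtain l where s: "s = Suc l" and "0 < l" by (cases s) auto
  have Q: "pell y = pell (Suc s) + pell l" using assms pell_lucas_Suc[of l] by (simp add: s)
  hence "pell (Suc s) < pell y" using pell_pos[OF \<open>0 < l\<close>] by simp
  moreover have "pell y < pell (Suc (Suc s))"
    using Q pell_mono[of l s] pell_pos[of s] by (simp add: s)
  ultimately have "Suc s < y" "y < Suc (Suc s)"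
    using pell_mono[of y "Suc s"] pell_mono[of "Suc (Suc s)" y] by linarith+
  then show ?thesis by simp
qed

text \<open>The bound 5 is where the small multiple of P_m may vanish: P_y = Q_s forces y = 2 and s
  \<le> 1, so m = y + s + j \<le> 5.\<close>

lemma multiplier_bound:
  assumes dvd: "int (pell m) dvd int (pell (m + k + j)) - int (pell_lucas k)"
    and j: "j = 1 \<or> j = 2 \<or> j = 3 \<and> k = 0"
  shows "m \<le> 5"
proof (rule ccontr)
  assume "\<not> m \<le> 5"
  hence m: "6 \<le> m" by simp
  define s where "s = k mod m"
  have s: "s < m" using m by (simp add: s_def)
  have js: "j = 1 \<or> j = 2 \<or> j = 3 \<and> s = 0" using j by (auto simp: s_def)
  have d: "int (pell m) dvd int (pell (m + s + j)) - int (pell_lucas s)"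
    unfolding s_def using pell_dvd_reduce[OF dvd] .
  have small: False if "int (pell m) dvd z" "\<bar>z\<bar> < int (pell m)" "z \<noteq> 0" for z
    using that zdvd_not_zless[of "\<bar>z\<bar>" "int (pell m)"] by simp
  define l where "l = m - 3"
  have ml: "m = Suc (Suc (Suc l))" and l3: "3 \<le> l" using m by (auto simp: l_def)
  have l5: "5 \<le> pell l" using l3 pell_mono[of 3 l] by (simp add: numeral_eq_Suc)
  have lmono: "pell l \<le> pell (Suc l)" by (simp add: pell_mono)
  \<comment> \<open>Q_(m-1) exceeds P_m, so for s = m - 1 it must first be reduced, to
    P_(m-2).\<close>
  have last: "int (pell_lucas s) = int (pell m) + int (pell (Suc l))" if "Suc s = m"
    using that pell_lucas_Suc[of "Suc l"] by (simp add: ml)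
  show False
  proof (cases "s + j \<le> m")
    case True
    define y where "y = m - s - j"
    have y: "y + (s + j) = m" using True by (simp add: y_def)
    have "int (pell (m + s + j)) = int (pell_lucas (s + j)) * int (pell m) - (-1) ^ (s + j) * int (pell y)"
    proof -
      have "y + 2 * (s + j) = m + s + j" using y by simp
      thus ?thesis using pell_reflection[of y "s + j"] by (simp only: y)
    qed
    hence d': "int (pell m) dvd (-1) ^ (s + j) * int (pell y) + int (pell_lucas s)"
      using d by (smt (verit) dvd_triv_right dvd_diff)
    show False
    proof (cases "Suc s = m")
      case True
      with y js have "y = 0" by auto
      hence "int (pell m) dvd int (pell m) + int (pell (Suc l))" using d' last[OF True] by simp
      hence "int (pell m) dvd int (pell (Suc l))" by (metis dvd_add_right_iff dvd_refl)
      thus False using small[of "int (pell (Suc l))"] lmono l5 by (simp add: ml)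
    next
      case False
      hence "y + j \<ge> 2" using s y by linarith
      have "pell_lucas s + pell y < pell m"
      proof (cases s)
        case 0
        have "pell y \<le> pell (Suc (Suc l))" using y js by (intro pell_mono) (auto simp: ml)
        thus ?thesis using 0 lmono l5 by (simp add: ml)
      next
        case (Suc i)
        have "pell y < pell (y + j)" using js \<open>y + j \<ge> 2\<close> by (intro pell_less) auto
        moreover have "Suc i + (y + j) = m" using y Suc by simp
        ultimately show ?thesis using pell_lucas_add_pell_le[OF \<open>y + j \<ge> 2\<close>, of i] Suc by simp
      qed
      hence bound: "int (pell_lucas s) + int (pell y) < int (pell m)" by linarith
      have pos: "2 \<le> int (pell_lucas s)" using pell_lucas_ge[of s] by linarith
      have sign: "(-1::int) ^ (s + j) = 1 \<or> (-1::int) ^ (s + j) = -1"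
        by (simp add: minus_one_power_iff)
      have "\<bar>(-1) ^ (s + j) * int (pell y) + int (pell_lucas s)\<bar> < int (pell m)"
        using sign bound pos by (auto simp: abs_less_iff)
      hence "(-1) ^ (s + j) * int (pell y) + int (pell_lucas s) = 0"
        using small[OF d'] by blast
      hence "pell y = pell_lucas s" using sign pos by auto
      hence "y = 2 \<and> s \<le> 1" by (rule pell_eq_pell_lucas)
      thus False using y js m by auto
    qed
  next
    case False
    \<comment> \<open>Reflection would lead to the index -1 here. Instead P_(2m+1) = P_(m+1)^2 +
      P_m^2, where P_(m+1)^2 is (-1)^m modulo P_m by Cassini's identity; what remains is (-1)^m -
      P_(m-2), nonzero and too small.\<close>
    hence sj: "Suc s = m" "j = 2" using s js m by auto
    have "m + s + j = Suc (m + m)" using sj by simp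
    hence "int (pell (m + s + j)) = int (pell (Suc m)) ^ 2 + int (pell m) ^ 2"
      using pell_add[of m m] by (simp only: power2_eq_square of_nat_add of_nat_mult)
    also have "\<dots> = (-1) ^ m + int (pell m) * (2 * int (pell (Suc m)) + 2 * int (pell m))"
      using pell_cassini[of m] by (simp add: algebra_simps power2_eq_square)
    finally have "int (pell (m + s + j)) - int (pell_lucas s)
        = ((-1) ^ m - int (pell (Suc l))) + int (pell m) * (2 * int (pell (Suc m)) + 2 * int (pell m) - 1)"
      using last[OF sj(1)] by (simp add: algebra_simps)
    hence "int (pell m) dvd (-1) ^ m - int (pell (Suc l))"
      using d by (metis dvd_add_left_iff dvd_triv_left)
    moreover have "(-1::int) ^ m = 1 \<or> (-1::int) ^ m = -1"
      by (simp add: minus_one_power_iff)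
    ultimately show False
      using small[of "(-1) ^ m - int (pell (Suc l))"] lmono l5 by (auto simp: ml)
  qed
qed

section \<open>A modular sieve for each triple (b, m, j)\<close>

text \<open>Integer-valued because \<open>code_simp\<close> computes with \<open>int\<close> in binary but with \<open>nat\<close> in unary.\<close>

fun pell_from :: "nat \<Rightarrow> int \<Rightarrow> int \<Rightarrow> int" where
  "pell_from 0 x y = x"
| "pell_from (Suc n) x y = pell_from n y (2 * y + x)"

lemma pell_from_pell: "pell_from n (int (pell i)) (int (pell (Suc i))) = int (pell (i + n))"
proof (induction n arbitrary: i)
  case (Suc n)
  show ?case using Suc.IH[of "Suc i"] by simp
qed simp

lemma pell_from_pell_lucas:
  "pell_from n (int (pell_lucas i)) (int (pell_lucas (Suc i))) = int (pell_lucas (i + n))"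
proof (induction n arbitrary: i)
  case (Suc n)
  show ?case using Suc.IH[of "Suc i"] by simp
qed simp

lemma int_pell_code: "int (pell n) = pell_from n 0 1"
  using pell_from_pell[of n 0] by simp

lemma int_pell_lucas_code: "int (pell_lucas n) = pell_from n 2 2"
  using pell_from_pell_lucas[of n 0] by simp

text \<open>The pair (x, y) stands for consecutive Pell numbers modulo \<open>M\<close>. The base
  clause demands a return to (0, 1), so that one period settles all indices.\<close>

fun pell_orbit_avoids :: "int \<Rightarrow> int list \<Rightarrow> int \<Rightarrow> int \<Rightarrow> nat \<Rightarrow> int \<Rightarrow> int \<Rightarrow> bool" where
  "pell_orbit_avoids M R u v 0 x y \<longleftrightarrow> x = 0 \<and> y = 1"
| "pell_orbit_avoids M R u v (Suc l) x y \<longleftrightarrow>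
     (u * y + v * x) mod M \<notin> set R \<and> pell_orbit_avoids M R u v l y ((2 * y + x) mod M)"

fun geometric_residues :: "int \<Rightarrow> int \<Rightarrow> nat \<Rightarrow> int \<Rightarrow> int list" where
  "geometric_residues M b 0 r = []"
| "geometric_residues M b (Suc l) r = r # geometric_residues M b l (r * b mod M)"

lemma mod_linear_combination:
  "(u * (x mod M) + v * (y mod M)) mod M = (u * x + v * y) mod M" for M :: int
  by (metis mod_add_eq mod_mult_right_eq)

lemma pell_rec_mod:
  "(2 * (int (pell (Suc i)) mod M) + int (pell i) mod M) mod M = int (pell (Suc (Suc i))) mod M"
  using mod_linear_combination[of 2 "int (pell (Suc i))" M 1 "int (pell i)"] by simp

lemma pell_orbit_avoids_run:
  assumes "pell_orbit_avoids M R u v L (int (pell i) mod M) (int (pell (Suc i)) mod M)"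
  shows "l < L \<Longrightarrow> (u * int (pell (Suc (i + l))) + v * int (pell (i + l))) mod M \<notin> set R"
    and "int (pell (i + L)) mod M = 0" and "int (pell (Suc (i + L))) mod M = 1"
proof -
  have "(\<forall>l < L. (u * int (pell (Suc (i + l))) + v * int (pell (i + l))) mod M \<notin> set R)
      \<and> int (pell (i + L)) mod M = 0 \<and> int (pell (Suc (i + L))) mod M = 1"
    using assms
  proof (induction L arbitrary: i)
    case (Suc L)
    have now: "(u * int (pell (Suc i)) + v * int (pell i)) mod M \<notin> set R"
      using Suc.prems by (simp add: mod_linear_combination)
    have "pell_orbit_avoids M R u v L (int (pell (Suc i)) mod M) (int (pell (Suc (Suc i))) mod M)"
      using Suc.prems by (simp only: pell_orbit_avoids.simps pell_rec_mod)
    note IH = Suc.IH[OF this]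
    have "(u * int (pell (Suc (i + l))) + v * int (pell (i + l))) mod M \<notin> set R" if "l < Suc L" for l
      using now IH that by (cases l) auto
    then show ?case using IH by auto
  qed simp
  thus "l < L \<Longrightarrow> (u * int (pell (Suc (i + l))) + v * int (pell (i + l))) mod M \<notin> set R"
    and "int (pell (i + L)) mod M = 0" and "int (pell (Suc (i + L))) mod M = 1" by auto
qed

lemma pell_periodic:
  assumes "int (pell L) mod M = 0" "int (pell (Suc L)) mod M = 1 mod M"
  shows "int (pell (k + L)) mod M = int (pell k) mod M"
proof (induction k rule: pell.induct)
  case (3 k)
  have "int (pell (Suc (Suc k) + L)) mod M
      = (2 * (int (pell (Suc k + L)) mod M) + int (pell (k + L)) mod M) mod M"
    by (simp only: add_Suc pell_rec_mod)
  also have "\<dots> = int (pell (Suc (Suc k))) mod M"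
    unfolding "3.IH" by (rule pell_rec_mod)
  finally show ?case .
qed (use assms in simp_all)

lemma pell_orbit_avoids_all:
  assumes "pell_orbit_avoids M R u v L 0 1" "1 < M" "0 < L"
  shows "(u * int (pell (Suc k)) + v * int (pell k)) mod M \<notin> set R"
proof -
  have "pell_orbit_avoids M R u v L (int (pell 0) mod M) (int (pell (Suc 0)) mod M)"
    using assms by simp
  note run = pell_orbit_avoids_run[OF this, simplified]
  have per: "int (pell (i + L)) mod M = int (pell i) mod M" for i
    using pell_periodic[of L M i] run(2,3) assms(2) by simp
  show ?thesis
  proof (induction k rule: less_induct)
    case (less k)
    show ?case
    proof (cases "k < L")
      case True
      then show ?thesis by (rule run(1))
    next
      case False
      define i where "i = k - L"
      have k: "k = i + L" using False by (simp add: i_def)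
      have "(u * int (pell (Suc k)) + v * int (pell k)) mod M
          = (u * (int (pell (Suc i + L)) mod M) + v * (int (pell (i + L)) mod M)) mod M"
        by (simp only: k add_Suc mod_linear_combination)
      also have "\<dots> = (u * int (pell (Suc i)) + v * int (pell i)) mod M"
        unfolding per by (rule mod_linear_combination)
      finally show ?thesis using less.IH[of i] k assms(3) by simp
    qed
  qed
qed

lemma geometric_residues_mem:
  "i < l \<Longrightarrow> r * b ^ i mod M \<in> set (geometric_residues M b l (r mod M))"
proof (induction l arbitrary: i r)
  case (Suc l)
  show ?case
  proof (cases i)
    case (Suc i')
    have "r * b * b ^ i' mod M \<in> set (geometric_residues M b l (r * b mod M))"
      using Suc.IH[of i' "r * b"] Suc.prems Suc by simp
    then show ?thesis using Suc by (simp add: mod_simps mult.assoc)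
  qed simp
qed simp

lemma geometric_residues_all:
  assumes "0 < E" "r * b ^ E mod M = r mod M"
  shows "r * b ^ i mod M \<in> set (geometric_residues M b E (r mod M))"
proof (induction i rule: less_induct)
  case (less i)
  show ?case
  proof (cases "i < E")
    case True
    then show ?thesis by (rule geometric_residues_mem)
  next
    case False
    define h where "h = i - E"
    have i: "i = E + h" using False by (simp add: h_def)
    have "r * b ^ i mod M = (r * b ^ E mod M) * b ^ h mod M"
      by (simp add: i power_add mod_simps mult.assoc)
    also have "\<dots> = r * b ^ h mod M" unfolding assms(2) by (simp add: mod_simps)
    finally show ?thesis using less.IH[of h] i assms(1) by simp
  qed
qed

text \<open>Starting at exponent \<open>e\<close> makes the powers purely periodic although
  \<open>b\<close> and \<open>M\<close> may share factors. The two coefficients express P_(m+k+j) -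
  Q_k through P_(k+1) and P_k.\<close>

fun sieve_certificate :: "nat \<times> nat \<times> nat \<times> nat \<times> nat \<times> int \<times> nat \<Rightarrow> bool" where
  "sieve_certificate (b, m, j, e, E, M, L) \<longleftrightarrow>
     (let r = pell_from m 0 1 * int b ^ e mod M; p = pell_from (m + j) 0 1 in
      1 < M \<and> 0 < E \<and> 0 < L \<and> r * int b ^ E mod M = r \<and>
      pell_orbit_avoids M (geometric_residues M (int b) E r)
        (p - 2) (pell_from (m + j + 1) 0 1 - 2 * p + 2) L 0 1)"

lemma sieve_certificate_sound:
  assumes "sieve_certificate (b, m, j, e, E, M, L)" and "e \<le> d"
  shows "pell (m + k + j) \<noteq> b ^ d * pell m + pell_lucas k"
proof
  assume eq: "pell (m + k + j) = b ^ d * pell m + pell_lucas k"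
  define r where "r = int (pell m) * int b ^ e"
  define p where "p = int (pell (m + j))"
  define v where "v = int (pell (Suc (m + j))) - 2 * p + 2"
  have cert: "1 < M" "0 < E" "0 < L" "(r mod M) * int b ^ E mod M = r mod M"
      "pell_orbit_avoids M (geometric_residues M (int b) E (r mod M)) (p - 2) v L 0 1"
    using assms(1) by (simp_all add: Let_def int_pell_code[symmetric] r_def p_def v_def)
  have avoid: "((p - 2) * int (pell (Suc k)) + v * int (pell k)) mod M
      \<notin> set (geometric_residues M (int b) E (r mod M))"
    using pell_orbit_avoids_all[OF cert(5,1,3)] .
  have "(p - 2) * int (pell (Suc k)) + v * int (pell k) = int (pell (k + (m + j))) - int (pell_lucas k)"
    unfolding int_pell_lucas int_pell_add v_def p_def by (simp add: algebra_simps)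
  also have "int (pell (k + (m + j))) = int (pell (m + k + j))" by (simp add: ac_simps)
  also have "\<dots> = int b ^ d * int (pell m) + int (pell_lucas k)" by (simp add: eq)
  finally have "(p - 2) * int (pell (Suc k)) + v * int (pell k) = r * int b ^ (d - e)"
    using assms(2) by (simp add: r_def power_add[symmetric] mult.assoc mult.commute)
  with avoid show False
    using geometric_residues_all[OF cert(2), of r "int b" M "d - e"] cert(4) by (simp add: mod_simps)
qed

text \<open>A row \<open>(b, m, j, e, E, M, L)\<close> rules out \<open>n = m + k + j\<close> for all digit counts \<open>d \<ge> e\<close> by
  reduction modulo \<open>M\<close>: the Pell numbers have period \<open>L\<close> modulo \<open>M\<close>, and \<open>b\<^sup>d P\<^sub>m\<close> has period \<open>E\<close> in
  \<open>d \<ge> e\<close>. Each \<open>M\<close> is \<open>b\<^sup>e P\<^sub>m\<close> times a few small primes, found by computer search.\<close>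

definition sieve_table :: "(nat \<times> nat \<times> nat \<times> nat \<times> nat \<times> int \<times> nat) list" where
  "sieve_table = [
    (2, 1, 1, 1, 2, 6, 8), (2, 1, 2, 3, 4, 120, 24), (2, 2, 1, 2, 4, 120, 24),
    (2, 2, 2, 6, 48, 5695777920, 384), (2, 3, 1, 2, 10, 660, 24), (2, 3, 2, 1, 1, 10, 12),
    (2, 4, 1, 1, 1, 24, 8), (2, 4, 2, 1, 1, 24, 8), (2, 5, 1, 1, 1, 58, 20),
    (2, 5, 2, 2, 2, 348, 40), (3, 1, 1, 3, 4, 135, 72), (3, 1, 2, 2, 4, 45, 24),
    (3, 2, 1, 1, 1, 6, 8), (3, 2, 2, 1, 1, 6, 8), (3, 3, 1, 2, 1, 45, 24),
    (3, 3, 2, 1, 1, 15, 24), (3, 4, 1, 1, 1, 36, 24), (3, 4, 2, 1, 1, 36, 24),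
    (3, 5, 1, 1, 1, 87, 40), (3, 5, 2, 1, 8, 17835, 120), (4, 1, 1, 1, 1, 12, 8),
    (4, 1, 2, 2, 1, 48, 16), (4, 2, 1, 1, 2, 40, 24), (4, 2, 2, 1, 1, 24, 8),
    (4, 3, 1, 2, 1, 240, 48), (4, 3, 2, 1, 1, 20, 12), (4, 4, 1, 1, 1, 48, 16),
    (4, 4, 2, 1, 1, 48, 16), (4, 5, 1, 1, 1, 116, 20), (4, 5, 2, 1, 1, 348, 40),
    (5, 1, 1, 1, 2, 15, 24), (5, 1, 2, 2, 3, 775, 60), (5, 2, 1, 2, 3, 1550, 60),
    (5, 2, 2, 2, 3, 1550, 60), (5, 3, 1, 1, 3, 775, 60), (5, 3, 2, 1, 1, 25, 60),
    (5, 4, 1, 1, 1, 60, 24), (5, 4, 2, 1, 1, 60, 24), (5, 5, 1, 1, 1, 145, 60),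
    (5, 5, 2, 1, 1, 145, 60), (6, 1, 1, 3, 1, 1080, 72), (6, 1, 2, 1, 1, 6, 8),
    (6, 2, 1, 1, 1, 12, 8), (6, 2, 2, 1, 1, 12, 8), (6, 3, 1, 1, 1, 30, 24),
    (6, 3, 2, 1, 1, 30, 24), (6, 4, 1, 1, 1, 72, 24), (6, 4, 2, 1, 1, 72, 24),
    (6, 5, 1, 1, 1, 174, 40), (6, 5, 2, 2, 1, 5220, 120), (7, 1, 1, 1, 1, 21, 24),
    (7, 1, 2, 1, 20, 1155, 24), (7, 2, 1, 2, 12, 6370, 84), (7, 2, 2, 1, 1, 14, 6),
    (7, 3, 1, 1, 1, 35, 12), (7, 3, 2, 1, 1, 35, 12), (7, 4, 1, 1, 1, 84, 24),
    (7, 4, 2, 1, 1, 84, 24), (7, 5, 1, 1, 1, 203, 60), (7, 5, 2, 1, 3, 11571, 120),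
    (8, 1, 1, 1, 2, 24, 8), (8, 1, 2, 1, 1, 56, 24), (8, 2, 1, 1, 1, 112, 48),
    (8, 2, 2, 1, 1, 112, 48), (8, 3, 1, 1, 1, 280, 24), (8, 3, 2, 1, 1, 40, 24),
    (8, 4, 1, 1, 1, 96, 32), (8, 4, 2, 1, 1, 96, 32), (8, 5, 1, 1, 1, 232, 40),
    (8, 5, 2, 1, 2, 696, 40), (9, 1, 1, 1, 6, 22995, 72), (9, 1, 2, 1, 2, 45, 24),
    (9, 2, 1, 1, 1, 18, 24), (9, 2, 2, 1, 1, 18, 24), (9, 3, 1, 1, 1, 45, 24),
    (9, 3, 2, 1, 1, 45, 24), (9, 4, 1, 1, 1, 108, 72), (9, 4, 2, 1, 1, 108, 72),
    (9, 5, 1, 1, 1, 261, 120), (9, 5, 2, 1, 2, 1305, 120), (10, 1, 1, 1, 1, 30, 24),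
    (10, 1, 2, 2, 2, 3300, 120), (10, 2, 1, 1, 2, 660, 24), (10, 2, 2, 2, 1, 600, 120),
    (10, 3, 1, 1, 2, 1650, 120), (10, 3, 2, 1, 1, 50, 60), (10, 4, 1, 1, 1, 120, 24),
    (10, 4, 2, 1, 1, 120, 24), (10, 5, 1, 1, 1, 290, 60), (10, 5, 2, 1, 1, 290, 60)]"

lemma sieve_table_correct: "list_all sieve_certificate sieve_table"
  by code_simp

text \<open>Besides completeness this records b^(e-1) \<le> Q_6: for d < e, the chain Q_k < b^d
  \<le> b^(e-1) \<le> Q_6 then gives k < 6.\<close>

lemma sieve_table_covers:
  "list_all (\<lambda>b. list_all (\<lambda>m. list_all (\<lambda>j.
     list_ex (\<lambda>(b', m', j', e, _).
       b' = b \<and> m' = m \<and> j' = j \<and> int b ^ (e - 1) \<le> pell_from 6 2 2 \<and> e \<le> 6) sieve_table)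
     [1, 2]) [1..<6]) [2..<11]"
  by code_simp

section \<open>The remaining finite search\<close>

lemma digits_bound:
  assumes "2 \<le> b" "b \<le> 10" "1 \<le> m" "m \<le> 5" "j = 1 \<or> j = 2"
    and eq: "pell (m + k + j) = b ^ d * pell m + pell_lucas k"
    and "pell_lucas k < b ^ d"
  shows "d < 6 \<and> k < 6"
proof -
  have "b \<in> set [2..<11]" "m \<in> set [1..<6]" "j \<in> set [1, 2]" using assms by auto
  with sieve_table_covers
  have "list_ex (\<lambda>(b', m', j', e, _).
       b' = b \<and> m' = m \<and> j' = j \<and> int b ^ (e - 1) \<le> pell_from 6 2 2 \<and> e \<le> 6) sieve_table"
    unfolding list_all_iff by blast
  then obtain e E M L where row: "(b, m, j, e, E, M, L) \<in> set sieve_table"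
    and e: "int b ^ (e - 1) \<le> pell_from 6 2 2" "e \<le> 6"
    by (auto simp: list_ex_iff)
  have "sieve_certificate (b, m, j, e, E, M, L)"
    using row sieve_table_correct unfolding list_all_iff by blast
  hence "d < e" using sieve_certificate_sound eq by (metis not_le)
  have "int b ^ (e - 1) \<le> int (pell_lucas 6)" using e(1) by (simp only: int_pell_lucas_code)
  hence "b ^ (e - 1) \<le> pell_lucas 6" by (metis of_nat_le_iff of_nat_power)
  moreover have "b ^ d \<le> b ^ (e - 1)" using \<open>d < e\<close> assms(1) by (intro power_increasing) auto
  ultimately have "pell_lucas k < pell_lucas 6" using assms(7) by linarith
  hence "k < 6" using pell_lucas_mono[of 6 k] by linarith
  with \<open>d < e\<close> e(2) show ?thesis by simp
qed

text \<open>The two inequalities on b^d stand in for the digit count, which keeps the check within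
  integer arithmetic.\<close>

lemma small_solutions_checked:
  "list_all (\<lambda>b. list_all (\<lambda>k. list_all (\<lambda>d.
     pell_from k 2 2 < int b ^ d \<and> int b ^ d \<le> int b * pell_from k 2 2 \<longrightarrow>
     list_all (\<lambda>m. list_all (\<lambda>j.
       pell_from (m + k + j) 0 1 = int b ^ d * pell_from m 0 1 + pell_from k 2 2 \<longrightarrow>
       (b, m + k + j, m, k) \<in> set [(3, 3, 1, 0), (3, 3, 1, 1), (5, 4, 2, 0), (5, 4, 2, 1),
                          (10, 4, 1, 0), (10, 4, 1, 1), (6, 6, 1, 4)])
     [1, 2, 3]) [1..<6]) [0..<6]) [0..<6]) [2..<11]"
  by code_simp

lemma small_solutions:
  assumes "2 \<le> b" "b \<le> 10" "1 \<le> m" "m \<le> 5" "1 \<le> j" "j \<le> 3" "k < 6" "d < 6"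
    and "pell (m + k + j) = b ^ d * pell m + pell_lucas k"
    and "pell_lucas k < b ^ d" "b ^ d \<le> b * pell_lucas k"
  shows "(b, m + k + j, m, k) \<in> {(3, 3, 1, 0), (3, 3, 1, 1), (5, 4, 2, 0), (5, 4, 2, 1),
                          (10, 4, 1, 0), (10, 4, 1, 1), (6, 6, 1, 4)}"
proof -
  have mem: "b \<in> set [2..<11]" "m \<in> set [1..<6]" "j \<in> set [1, 2, 3]" "k \<in> set [0..<6]" "d \<in> set [0..<6]"
    using assms by auto
  have "pell_from (m + k + j) 0 1 = int b ^ d * pell_from m 0 1 + pell_from k 2 2"
    using assms(9) unfolding int_pell_code[symmetric] int_pell_lucas_code[symmetric] by simp
  moreover have "pell_from k 2 2 < int b ^ d"
    unfolding int_pell_lucas_code[symmetric] using assms(10) by (metis of_nat_less_iff of_nat_power)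
  moreover have "int b ^ d \<le> int b * pell_from k 2 2"
    unfolding int_pell_lucas_code[symmetric] using assms(11) by (metis of_nat_le_iff of_nat_power of_nat_mult)
  ultimately have "(b, m + k + j, m, k) \<in> set [(3, 3, 1, 0), (3, 3, 1, 1), (5, 4, 2, 0), (5, 4, 2, 1),
                          (10, 4, 1, 0), (10, 4, 1, 1), (6, 6, 1, 4)]"
    using small_solutions_checked mem unfolding list_all_iff by blast
  thus ?thesis by simp
qed

theorem theorem3:
  fixes b n m k :: nat
  assumes "2 \<le> b" and "b \<le> 10" and "1 \<le> m"
  shows "pell n = b ^ num_digits b (pell_lucas k) * pell m + pell_lucas k \<longleftrightarrow>
         (b, n, m, k) \<in> {(3, 3, 1, 0), (3, 3, 1, 1), (5, 4, 2, 0), (5, 4, 2, 1),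
                          (10, 4, 1, 0), (10, 4, 1, 1), (6, 6, 1, 4)}"
proof
  define d where "d = num_digits b (pell_lucas k)"
  assume "pell n = b ^ num_digits b (pell_lucas k) * pell m + pell_lucas k"
  hence eq: "pell n = b ^ d * pell m + pell_lucas k" by (simp add: d_def)
  have "0 < pell_lucas k" using pell_lucas_ge[of k] by simp
  hence B: "pell_lucas k < b ^ d" "b ^ d \<le> b * pell_lucas k"
    unfolding d_def using num_digits_bounds[OF assms(1)] by auto
  have "b ^ d \<le> 10 * pell_lucas k" using B(2) assms(2) by (meson le_trans mult_le_mono1)
  then obtain j where n: "n = m + k + j" and j: "j = 1 \<or> j = 2 \<or> j = 3 \<and> k = 0"
    using index_range[OF eq assms(3) B(1)] by blast
  have "int (pell (m + k + j)) - int (pell_lucas k) = int (pell m) * int b ^ d"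
    using eq by (simp add: n mult.commute)
  hence m: "m \<le> 5" using multiplier_bound[OF _ j] by simp
  have "d < 6 \<and> k < 6"
  proof (cases "j = 3")
    case True
    \<comment> \<open>The sieve has no rows for j = 3, but here b^d \<le> 10 Q_0 = 20 < 2^6.\<close>
    hence k: "k = 0" using j by simp
    have "d < 6"
    proof (rule ccontr)
      assume "\<not> d < 6"
      hence "2 ^ 6 \<le> b ^ d"
        using assms(1) by (meson le_trans not_less one_le_numeral power_increasing power_mono zero_le)
      thus False using \<open>b ^ d \<le> 10 * pell_lucas k\<close> k by simp
    qed
    thus ?thesis using k by simp
  next
    case False
    thus ?thesis using digits_bound[OF assms m] j eq B(1) n by blast
  qed
  thus "(b, n, m, k) \<in> {(3, 3, 1, 0), (3, 3, 1, 1), (5, 4, 2, 0), (5, 4, 2, 1),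
                          (10, 4, 1, 0), (10, 4, 1, 1), (6, 6, 1, 4)}"
    unfolding n using j eq B m assms n by (intro small_solutions) auto
next
  \<comment> \<open>The values needed are Q_0 = Q_1 = 2 and Q_4 = 34, with 6 \<le> 34 < 36.\<close>
  have "num_digits 3 2 = Suc 0" "num_digits 5 2 = Suc 0" "num_digits 10 2 = Suc 0"
      "num_digits 6 34 = Suc 1"
    by (rule num_digits_eqI; simp)+
  moreover assume "(b, n, m, k) \<in> {(3, 3, 1, 0), (3, 3, 1, 1), (5, 4, 2, 0), (5, 4, 2, 1),
                          (10, 4, 1, 0), (10, 4, 1, 1), (6, 6, 1, 4)}"
  ultimately show "pell n = b ^ num_digits b (pell_lucas k) * pell m + pell_lucas k"
    by (auto simp: eval_nat_numeral)
qed

end
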